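(* Let $m,n\ge 1$ be integers. The cone of $Q_+(m)\otimes S_+(n)$-separable matrices in $\mathcal{Q}(m)\otimes\mathcal{S}(n)$ coincides with the cone of positive semidefinite matrices in $\mathcal{Q}(m)\otimes\mathcal{S}(n)$ if and only if $n\le 2$ or $m=1$.
   Context: $\mathcal{S}(n)$ is the real vector space of real symmetric $n\times n$ matrices and $S_+(n)$ its cone of positive semidefinite (PSD) matrices. $\mathcal{Q}(m)$ is the real vector space of quaternionic hermitian $m\times m$ matrices ($A=A^*$, with $*$ the quaternionic conjugate transpose) and $Q_+(m)$ its cone of PSD matrices, i.e. those $A$ with $v^*Av\ge 0$ for all $v\in\mathbb{H}^m$. The (real) tensor product $\mathcal{Q}(m)\otimes\mathcal{S}(n)$ is regarded as a subspace of $\mathcal{Q}(mn)$ via the Kronecker product ($m\times m$ blocks of size $n\times n$, $A\otimes B=(a_{\alpha\beta}B)$). A matrix is $Q_+(m)\otimes S_+(n)$-separable if it is a finite sum $\sum_l A_l\otimes B_l$ with $A_l\in Q_+(m)$, $B_l\in S_+(n)$. *)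

theory Defs
  imports "HOL-Analysis.Analysis"
begin

section \<open>Quaternions\<close>

text \<open>The quaternion \<open>Quat a b c d\<close> is $a + b i + c j + d k$.\<close>

datatype quat = Quat (qRe: real) (qIm1: real) (qIm2: real) (qIm3: real)

lemma quat_eq_iff:
  "p = q \<longleftrightarrow> qRe p = qRe q \<and> qIm1 p = qIm1 q \<and> qIm2 p = qIm2 q \<and> qIm3 p = qIm3 q"
  by (cases p; cases q) simp

instantiation quat :: real_algebra_1
begin

definition zero_quat :: quat where "0 = Quat 0 0 0 0"

definition one_quat :: quat where "1 = Quat 1 0 0 0"

definition plus_quat :: "quat \<Rightarrow> quat \<Rightarrow> quat" where
  "p + q = Quat (qRe p + qRe q) (qIm1 p + qIm1 q) (qIm2 p + qIm2 q) (qIm3 p + qIm3 q)"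

definition uminus_quat :: "quat \<Rightarrow> quat" where
  "- p = Quat (- qRe p) (- qIm1 p) (- qIm2 p) (- qIm3 p)"

definition minus_quat :: "quat \<Rightarrow> quat \<Rightarrow> quat" where
  "p - q = Quat (qRe p - qRe q) (qIm1 p - qIm1 q) (qIm2 p - qIm2 q) (qIm3 p - qIm3 q)"

definition scaleR_quat :: "real \<Rightarrow> quat \<Rightarrow> quat" where
  "r *\<^sub>R p = Quat (r * qRe p) (r * qIm1 p) (r * qIm2 p) (r * qIm3 p)"

definition times_quat :: "quat \<Rightarrow> quat \<Rightarrow> quat" where
  "p * q = Quat
     (qRe p * qRe q - qIm1 p * qIm1 q - qIm2 p * qIm2 q - qIm3 p * qIm3 q)
     (qRe p * qIm1 q + qIm1 p * qRe q + qIm2 p * qIm3 q - qIm3 p * qIm2 q)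
     (qRe p * qIm2 q - qIm1 p * qIm3 q + qIm2 p * qRe q + qIm3 p * qIm1 q)
     (qRe p * qIm3 q + qIm1 p * qIm2 q - qIm2 p * qIm1 q + qIm3 p * qRe q)"

instance
  by standard
    (simp_all add: quat_eq_iff zero_quat_def one_quat_def plus_quat_def uminus_quat_def
      minus_quat_def scaleR_quat_def times_quat_def algebra_simps)

end

definition qcnj :: "quat \<Rightarrow> quat" where
  "qcnj p = Quat (qRe p) (- qIm1 p) (- qIm2 p) (- qIm3 p)"

lemma qcnj_mult: "qcnj (p * q) = qcnj q * qcnj p"
  by (simp add: qcnj_def times_quat_def)

section \<open>Hermitian and positive semidefinite matrices\<close>

definition qadjoint :: "quat^'n^'m \<Rightarrow> quat^'m^'n" where
  "qadjoint A = (\<chi> i j. qcnj (A $ j $ i))"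

definition qherm :: "(quat^'m^'m) set" where
  "qherm = {A. qadjoint A = A}"

text \<open>The value $v^* A v$.\<close>

definition qform :: "quat^'m^'m \<Rightarrow> quat^'m \<Rightarrow> quat" where
  "qform A v = (\<Sum>i\<in>UNIV. qcnj (v $ i) * (A *v v) $ i)"

text \<open>The condition $v^* A v \ge 0$ is read as: the quaternion $v^* A v$ is a nonnegative
  real number.\<close>

definition qpsd :: "(quat^'m^'m) set" where
  "qpsd = {A \<in> qherm. \<forall>v. \<exists>r\<ge>0. qform A v = of_real r}"

definition rsym :: "(real^'n^'n) set" where
  "rsym = {B. transpose B = B}"

definition rpsd :: "(real^'n^'n) set" where
  "rpsd = {B \<in> rsym. \<forall>x. 0 \<le> x \<bullet> (B *v x)}"

section \<open>The tensor product and separability\<close>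

text \<open>Rows and columns of a Kronecker product are indexed by pairs \<open>(\<alpha>, i)\<close>, with
  \<open>\<alpha>\<close> the block index and \<open>i\<close> the position inside a block, instead of
  by $1,\dots,mn$. The block at \<open>(\<alpha>, \<beta>)\<close> is $a_{\alpha\beta} B$; real scalars
  are central in the quaternions, so it can be written with scalar multiplication.\<close>

definition kron :: "quat^'m^'m \<Rightarrow> real^'n^'n \<Rightarrow> quat^('m \<times> 'n)^('m \<times> 'n)" where
  "kron A B = (\<chi> p q. (B $ snd p $ snd q) *\<^sub>R (A $ fst p $ fst q))"

text \<open>The real tensor product of the quaternionic hermitian \<open>'m \<times> 'm\<close> matrices and the
  real symmetric \<open>'n \<times> 'n\<close> matrices, as a real subspace.\<close>

definition herm_tensor_sym :: "(quat^('m::finite \<times> 'n::finite)^('m \<times> 'n)) set" where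
  "herm_tensor_sym = span {kron A B | A B. A \<in> qherm \<and> B \<in> rsym}"

definition separable :: "quat^('m::finite \<times> 'n::finite)^('m \<times> 'n) \<Rightarrow> bool" where
  "separable M \<longleftrightarrow> (\<exists>(k::nat) A B.
     (\<forall>l<k. A l \<in> qpsd \<and> B l \<in> rpsd) \<and> M = (\<Sum>l<k. kron (A l) (B l)))"

end

theory Submission
  imports Defs
begin

text \<open>
  Rank reduction: if $A$ is PSD and $Ap \neq 0$, then $A - (Ap)(Ap)^* / (p^*Ap)$ is PSD and has a
  larger kernel. For $n \le 2$ write $X$, $Y$ for the diagonal and off-diagonal blocks
  in the first block column of $M$; both are hermitian. Maximising the Rayleigh quotient of $Y$
  against $X$ gives $u$ with $Yu = y Xu \neq 0$ and $y$ real, so for $p = u \otimes e_1$ the vector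
  $Mp = Xu \otimes (1, y)$ is a product and the subtracted term is separable.

  For $m \ge 2$, $n \ge 3$ an entangled matrix is $M = GG^*$, where $G$ is the $6 \times 4$ matrix
  with rows $(I, 0)$ and $(Q, v)$, for a symmetric quaternionic $3 \times 3$ matrix $Q$ and
  $v \in \mathbb{H}^3$ such that $QQ^* + vv^*$ is real. Every term of a separable decomposition
  of $M$ kills the kernel of $M$, so its rows are product vectors annihilating this kernel, and
  there are none.
\<close>

section \<open>The quaternions as a four-dimensional Euclidean space\<close>

lemmas quat_defs = zero_quat_def one_quat_def plus_quat_def uminus_quat_def
  minus_quat_def scaleR_quat_def times_quat_def qcnj_def

instantiation quat :: real_inner
begin

definition inner_quat :: "quat \<Rightarrow> quat \<Rightarrow> real" where
  "inner_quat p q = qRe p * qRe q + qIm1 p * qIm1 q + qIm2 p * qIm2 q + qIm3 p * qIm3 q"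

definition norm_quat :: "quat \<Rightarrow> real" where
  "norm_quat p = sqrt (inner p p)"

definition sgn_quat :: "quat \<Rightarrow> quat" where
  "sgn_quat p = p /\<^sub>R norm p"

definition dist_quat :: "quat \<Rightarrow> quat \<Rightarrow> real" where
  "dist_quat p q = norm (p - q)"

definition uniformity_quat :: "(quat \<times> quat) filter" where
  "uniformity_quat = (INF e\<in>{0 <..}. principal {(x, y). dist x y < e})"

definition open_quat :: "quat set \<Rightarrow> bool" where
  "open_quat U \<longleftrightarrow> (\<forall>x\<in>U. eventually (\<lambda>(x', y). x' = x \<longrightarrow> y \<in> U) uniformity)"

instance
proof
  fix x y z :: quat and r :: real and U :: "quat set"
  show "dist x y = norm (x - y)" by (rule dist_quat_def)
  show "sgn x = x /\<^sub>R norm x" by (rule sgn_quat_def)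
  show "uniformity = (INF e\<in>{0 <..}. principal {(x::quat, y). dist x y < e})"
    by (rule uniformity_quat_def)
  show "open U \<longleftrightarrow> (\<forall>x\<in>U. eventually (\<lambda>(x', y). x' = x \<longrightarrow> y \<in> U) uniformity)"
    by (rule open_quat_def)
  show "inner x y = inner y x" "inner (x + y) z = inner x z + inner y z"
    "inner (r *\<^sub>R x) y = r * inner x y" "0 \<le> inner x x"
    by (simp_all add: inner_quat_def quat_defs algebra_simps)
  show "inner x x = 0 \<longleftrightarrow> x = 0"
    by (simp add: inner_quat_def quat_defs quat_eq_iff add_nonneg_eq_0_iff)
  show "norm x = sqrt (inner x x)" by (rule norm_quat_def)
qed

end

text \<open>Finite real dimension gives the kernels of quaternionic matrices a \<open>dim\<close> to
  induct on and makes unit spheres compact.\<close>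

instantiation quat :: euclidean_space
begin

definition Basis_quat :: "quat set" where
  "Basis_quat = {Quat 1 0 0 0, Quat 0 1 0 0, Quat 0 0 1 0, Quat 0 0 0 1}"

instance
proof
  show "(Basis :: quat set) \<noteq> {}" "finite (Basis :: quat set)"
    by (simp_all add: Basis_quat_def)
  show "inner u v = (if u = v then 1 else 0)" if "u \<in> Basis" "v \<in> Basis" for u v :: quat
    using that unfolding Basis_quat_def insert_iff empty_iff
    by (elim disjE) (simp_all only: inner_quat_def quat.sel quat.inject simp_thms, simp_all)
  show "(\<forall>u\<in>Basis. inner x u = 0) \<longleftrightarrow> x = 0" for x :: quat
    by (cases x) (simp add: Basis_quat_def inner_quat_def zero_quat_def)
qed

end

lemma inner_quat_mult_left: "inner (a * b) c = inner b (qcnj a * c)"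
  by (simp add: inner_quat_def quat_defs algebra_simps)

lemma inner_quat_1: "inner (1::quat) 1 = 1"
  by (simp add: inner_quat_def quat_defs)

lemma qcnj_qcnj [simp]: "qcnj (qcnj p) = p"
  by (simp add: qcnj_def)

lemma qcnj_0 [simp]: "qcnj 0 = 0"
  by (simp add: quat_defs)

lemma qcnj_add: "qcnj (p + q) = qcnj p + qcnj q"
  by (simp add: quat_defs)

lemma qcnj_scaleR: "qcnj (r *\<^sub>R p) = r *\<^sub>R qcnj p"
  by (simp add: quat_defs)

lemma qcnj_sum: "qcnj (sum f S) = (\<Sum>x\<in>S. qcnj (f x))"
  by (induction S rule: infinite_finite_induct) (simp_all add: qcnj_add)

lemma of_real_quat: "of_real r = Quat r 0 0 0"
  by (simp add: of_real_def quat_defs)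

lemma quat_mult_qcnj: "q * qcnj q = of_real (inner q q)"
  by (simp add: of_real_quat inner_quat_def quat_defs)

text \<open>Multiplying \<open>p * q\<close> on the right by \<open>qcnj q\<close> leaves
  \<open>p\<close> scaled by the squared norm of \<open>q\<close>.\<close>

lemma quat_no_zero_divisors:
  fixes p q :: quat
  assumes "p * q = 0"
  shows "p = 0 \<or> q = 0"
proof -
  have "inner q q *\<^sub>R p = p * (q * qcnj q)"
    unfolding quat_mult_qcnj by (simp add: of_real_def)
  also have "\<dots> = 0"
    using assms by (simp flip: mult.assoc)
  finally show ?thesis by auto
qed

section \<open>Hermitian matrices as self-adjoint real operators\<close>

definition hdot :: "quat^'n \<Rightarrow> quat^'n \<Rightarrow> quat" where
  "hdot u v = (\<Sum>i\<in>UNIV. qcnj (u $ i) * v $ i)"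

definition outer :: "quat^'n \<Rightarrow> quat^'n^'n" where
  "outer g = (\<chi> i j. g $ i * qcnj (g $ j))"

text \<open>Scalars act from the right, the side on which they commute with a matrix acting from the
  left.\<close>

definition vmultr :: "quat^'n \<Rightarrow> quat \<Rightarrow> quat^'n" where
  "vmultr v t = (\<chi> i. v $ i * t)"

lemma qherm_iff: "A \<in> qherm \<longleftrightarrow> (\<forall>i j. qcnj (A $ j $ i) = A $ i $ j)"
  by (auto simp: qherm_def qadjoint_def vec_eq_iff)

lemma qhermD: "A \<in> qherm \<Longrightarrow> qcnj (A $ j $ i) = A $ i $ j"
  by (simp add: qherm_iff)

lemma subspace_qherm: "subspace qherm"
  by (auto simp: subspace_def qherm_iff qcnj_add qcnj_scaleR)

lemma outer_qherm: "outer g \<in> qherm"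
  by (simp add: qherm_iff outer_def qcnj_mult)

lemma linear_matrix_vector: "linear (\<lambda>v. (A :: quat^'n^'m) *v v)"
  by (rule linearI)
    (simp_all add: matrix_vector_mult_def vec_eq_iff sum.distrib distrib_left scaleR_sum_right)

lemma scaleR_matrix_vector: "(r *\<^sub>R (A :: quat^'n^'m)) *v v = r *\<^sub>R (A *v v)"
  by (simp add: matrix_vector_mult_def vec_eq_iff scaleR_sum_right)

lemma sum_matrix_vector: "(\<Sum>l\<in>S. (A l :: quat^'n^'m)) *v v = (\<Sum>l\<in>S. A l *v v)"
  by (induction S rule: infinite_finite_induct)
    (simp_all add: matrix_vector_mult_add_rdistrib)

lemma matrix_vector_axis: "(A *v axis p (c::quat)) $ q = A $ q $ p * c"
proof -
  have "(A *v axis p c) $ q = (\<Sum>j\<in>UNIV. if j = p then A $ q $ j * c else 0)"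
    unfolding matrix_vector_mult_def axis_def vec_lambda_beta by (intro sum.cong) auto
  then show ?thesis by simp
qed

lemma hdot_axis: "hdot u (axis p c) = qcnj (u $ p) * c"
proof -
  have "hdot u (axis p c) = (\<Sum>j\<in>UNIV. if j = p then qcnj (u $ j) * c else 0)"
    unfolding hdot_def axis_def vec_lambda_beta by (intro sum.cong) auto
  then show ?thesis by simp
qed

lemma hdot_add: "hdot u (v + w) = hdot u v + hdot u w"
  by (simp add: hdot_def sum.distrib distrib_left)

lemma outer_matrix_vector: "outer g *v w = vmultr g (hdot g w)"
  by (simp add: outer_def matrix_vector_mult_def vmultr_def hdot_def vec_eq_iff
      sum_distrib_left mult.assoc)

lemma matrix_vector_vmultr: "A *v vmultr v t = vmultr (A *v v) t"
  by (simp add: matrix_vector_mult_def vmultr_def vec_eq_iff sum_distrib_right mult.assoc)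

lemma inner_vmultr: "inner (vmultr v t) w = inner t (hdot v w)"
  by (simp add: inner_vec_def vmultr_def hdot_def inner_sum_right inner_quat_mult_left)

lemma inner_outer: "inner w (outer g *v w) = inner (hdot g w) (hdot g w)"
  by (simp add: outer_matrix_vector inner_commute[of w] inner_vmultr)

lemma hdot_vmultr: "hdot u (vmultr v t) = hdot u v * t"
  by (simp add: hdot_def vmultr_def sum_distrib_right mult.assoc)

text \<open>The order of the three factors in u^* A v survives swapping the two sums, so
  noncommutativity does no harm. The second claim is the real part of the first.\<close>

lemma qherm_self_adjoint:
  assumes "A \<in> qherm"
  shows "hdot u (A *v v) = hdot (A *v u) v" "inner u (A *v v) = inner (A *v u) v"
proof -
  show *: "hdot u (A *v v) = hdot (A *v u) v" for u v
  proof -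
    have "hdot u (A *v v) = (\<Sum>i\<in>UNIV. \<Sum>j\<in>UNIV. qcnj (u $ i) * A $ i $ j * v $ j)"
      by (simp add: hdot_def matrix_vector_mult_def sum_distrib_left mult.assoc)
    also have "\<dots> = (\<Sum>j\<in>UNIV. \<Sum>i\<in>UNIV. qcnj (u $ i) * A $ i $ j * v $ j)"
      by (rule sum.swap)
    also have "\<dots> = hdot (A *v u) v"
      by (simp add: hdot_def matrix_vector_mult_def qcnj_sum qcnj_mult qhermD[OF assms]
          sum_distrib_right)
    finally show ?thesis .
  qed
  have re: "inner u v = inner 1 (hdot u v)" for u v :: "quat^'a"
    using inner_vmultr[of u 1 v] by (simp add: vmultr_def)
  show "inner u (A *v v) = inner (A *v u) v"
    by (simp add: re *)
qed

lemma qcnj_hdot: "qcnj (hdot u v) = hdot v u"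
  by (simp add: hdot_def qcnj_sum qcnj_mult)

text \<open>The value equals its own conjugate, so it is real, and its real part is the Euclidean
  inner product. Positivity thus becomes a property of a real self-adjoint operator.\<close>

lemma qform_qherm:
  assumes "A \<in> qherm"
  shows "qform A v = of_real (inner v (A *v v))"
proof -
  have eq: "qform A v = hdot v (A *v v)"
    by (simp add: qform_def hdot_def)
  have "qcnj (qform A v) = qform A v"
    by (simp add: eq qcnj_hdot qherm_self_adjoint(1)[OF assms])
  then have "qform A v = Quat (qRe (qform A v)) 0 0 0"
    by (simp add: quat_eq_iff qcnj_def)
  moreover have "inner v (A *v v) = qRe (qform A v)"
    using inner_vmultr[of v 1 "A *v v"] by (simp add: vmultr_def eq inner_quat_def quat_defs)
  ultimately show ?thesis
    by (simp add: of_real_quat)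
qed

lemma qpsd_iff: "A \<in> qpsd \<longleftrightarrow> A \<in> qherm \<and> (\<forall>v. 0 \<le> inner v (A *v v))"
  by (auto simp: qpsd_def qform_qherm)

lemma qpsd_add: "A \<in> qpsd \<Longrightarrow> B \<in> qpsd \<Longrightarrow> A + B \<in> qpsd"
  by (simp add: qpsd_iff matrix_vector_mult_add_rdistrib inner_right_distrib
      subspace_add[OF subspace_qherm])

lemma qpsd_0: "0 \<in> qpsd"
  by (simp add: qpsd_iff subspace_0[OF subspace_qherm])

lemma qpsd_sum: "(\<And>l. l \<in> S \<Longrightarrow> A l \<in> qpsd) \<Longrightarrow> sum A S \<in> qpsd"
  by (induction S rule: infinite_finite_induct) (auto intro: qpsd_add qpsd_0)

lemma qpsd_scaleR: "0 \<le> r \<Longrightarrow> A \<in> qpsd \<Longrightarrow> r *\<^sub>R A \<in> qpsd"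
  by (simp add: qpsd_iff scaleR_matrix_vector subspace_scale[OF subspace_qherm])

lemma outer_qpsd: "outer g \<in> qpsd"
  by (simp add: qpsd_iff outer_qherm inner_outer)

text \<open>At \<open>u - t *\<^sub>R f u\<close> the form has the value -2ta + t^2 b with a the
  squared norm of \<open>f u\<close>. This is negative for small t > 0 unless a = 0.\<close>

lemma nonneg_self_adjoint_eq_0:
  fixes f :: "'a::real_inner \<Rightarrow> 'a"
  assumes lin: "linear f" and sa: "\<And>u v. inner u (f v) = inner (f u) v"
    and nn: "\<And>v. 0 \<le> inner v (f v)" and "inner u (f u) = 0"
  shows "f u = 0"
proof (rule ccontr)
  assume "f u \<noteq> 0"
  define w where "w = f u"
  define a b where "a = inner w w" and "b = inner w (f w)"
  have "a > 0" using \<open>f u \<noteq> 0\<close> by (simp add: a_def w_def)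
  have "b \<ge> 0" using nn by (simp add: b_def)
  have ufw: "inner u (f w) = a" unfolding a_def w_def by (rule sa)
  have q: "0 \<le> - (2 * t * a) + t\<^sup>2 * b" for t
  proof -
    have "inner (u - t *\<^sub>R w) (f (u - t *\<^sub>R w))
        = inner u (f u) - t * inner u (f w) - t * inner w (f u) + t * t * inner w (f w)"
      by (simp add: linear_diff[OF lin] linear_scale[OF lin] inner_diff_left inner_diff_right
          algebra_simps)
    also have "\<dots> = - (2 * t * a) + t\<^sup>2 * b"
      unfolding ufw assms(4) by (simp add: a_def b_def power2_eq_square flip: w_def)
    finally show ?thesis using nn[of "u - t *\<^sub>R w"] by simp
  qed
  \<comment> \<open>The denominator is \<open>b + 1\<close> because \<open>b\<close> may vanish; it
    gives \<open>t * b = a - t\<close>, which is below \<open>2 * a\<close>.\<close>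
  define t where "t = a / (b + 1)"
  have "t > 0" using \<open>a > 0\<close> \<open>b \<ge> 0\<close> by (simp add: t_def)
  have "t * (b + 1) = a" using \<open>b \<ge> 0\<close> by (simp add: t_def)
  then have "t * b < 2 * a" using \<open>a > 0\<close> \<open>t > 0\<close> by (simp add: distrib_left)
  then have "t * (t * b) < t * (2 * a)" using \<open>t > 0\<close> by simp
  then show False using q[of t] by (simp add: power2_eq_square)
qed

lemma qpsd_eq_0:
  assumes "A \<in> qpsd" "inner u (A *v u) = 0"
  shows "A *v u = 0"
  using nonneg_self_adjoint_eq_0[OF linear_matrix_vector, of A u] assms qherm_self_adjoint(2)[of A]
  by (auto simp: qpsd_iff)

section \<open>Rank reduction\<close>

text \<open>Wedderburn's rank reduction in quaternionic form. If the form vanishes at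
  \<open>p\<close>, division by zero makes the value \<open>A\<close> itself.\<close>

definition deflate :: "quat^'n^'n \<Rightarrow> quat^'n \<Rightarrow> quat^'n^'n" where
  "deflate A p = A - (1 / inner p (A *v p)) *\<^sub>R outer (A *v p)"

lemma qpsd_form_pos:
  assumes "A \<in> qpsd" "A *v p \<noteq> 0"
  shows "inner p (A *v p) > 0"
  using assms qpsd_eq_0[OF assms(1), of p] by (force simp: qpsd_iff order_less_le)

lemma deflate_matrix_vector:
  "deflate A p *v w = A *v w - (1 / inner p (A *v p)) *\<^sub>R vmultr (A *v p) (hdot (A *v p) w)"
  by (simp add: deflate_def matrix_vector_mult_diff_rdistrib scaleR_matrix_vector
      outer_matrix_vector)

text \<open>The new form at w is the form of A at w - p t, where t = (A p)^* w / (p^* A p) removes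
  from w its component along p with respect to A.\<close>

lemma deflate_qpsd:
  assumes A: "A \<in> qpsd" and p: "A *v p \<noteq> 0"
  shows "deflate A p \<in> qpsd"
  unfolding qpsd_iff
proof (intro conjI allI)
  have h: "A \<in> qherm" using A by (simp add: qpsd_iff)
  show "deflate A p \<in> qherm"
    unfolding deflate_def
    by (intro subspace_diff[OF subspace_qherm] subspace_scale[OF subspace_qherm] h outer_qherm)
  fix w
  define c where "c = inner p (A *v p)"
  have c: "c > 0" unfolding c_def by (rule qpsd_form_pos[OF A p])
  define s where "s = hdot (A *v p) w"
  define t where "t = (1 / c) *\<^sub>R s"
  let ?z = "vmultr p t"
  have pAp: "hdot p (A *v p) = of_real c"
    using qform_qherm[OF h, of p] by (simp add: qform_def hdot_def c_def)
  have z1: "inner ?z (A *v w) = inner t s"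
    by (simp add: inner_vmultr s_def qherm_self_adjoint(1)[OF h])
  have z2: "inner w (A *v ?z) = inner t s"
    using z1 by (simp add: qherm_self_adjoint(2)[OF h] inner_commute)
  have z3: "inner ?z (A *v ?z) = c * inner t t"
    by (simp add: inner_vmultr matrix_vector_vmultr hdot_vmultr pAp of_real_def)
  have "0 \<le> inner (w - ?z) (A *v (w - ?z))"
    using A by (simp add: qpsd_iff)
  also have "\<dots> = inner w (A *v w) - 2 * inner t s + c * inner t t"
    by (simp add: linear_diff[OF linear_matrix_vector] inner_diff_left inner_diff_right z1 z2 z3)
  also have "\<dots> = inner w (A *v w) - (1 / c) * inner s s"
    using c by (simp add: t_def field_simps)
  also have "\<dots> = inner w (deflate A p *v w)"
    by (simp add: deflate_def matrix_vector_mult_diff_rdistrib scaleR_matrix_vector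
        inner_diff_right inner_outer s_def c_def)
  finally show "0 \<le> inner w (deflate A p *v w)" .
qed

text \<open>If A v = 0 then (A p)^* v = p^* A v = 0, so nothing is subtracted at v. The new kernel
  vector is p.\<close>

lemma deflate_kernel:
  assumes A: "A \<in> qpsd" and p: "A *v p \<noteq> 0"
  shows "{v. A *v v = 0} \<subset> {v. deflate A p *v v = 0}"
proof -
  have h: "A \<in> qherm" using A by (simp add: qpsd_iff)
  have "deflate A p *v v = 0" if "A *v v = 0" for v
  proof -
    have "hdot (A *v p) v = hdot p (A *v v)" by (simp add: qherm_self_adjoint(1)[OF h])
    then show ?thesis using that by (simp add: deflate_matrix_vector hdot_def vmultr_def vec_eq_iff)
  qed
  moreover have "deflate A p *v p = 0"
  proof -
    have "hdot (A *v p) p = of_real (inner p (A *v p))"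
      using qform_qherm[OF h, of p]
      by (simp add: qform_def hdot_def[symmetric] qherm_self_adjoint(1)[OF h])
    then show ?thesis
      using qpsd_form_pos[OF A p]
      by (simp add: deflate_matrix_vector vmultr_def vec_eq_iff of_real_def)
  qed
  ultimately show ?thesis using p by blast
qed

text \<open>Induction on the real codimension of the kernel. The base case hides in
  \<open>step\<close>: for \<open>A = 0\<close> no \<open>p\<close> qualifies, so \<open>P A\<close>
  must be proved outright.\<close>

lemma qpsd_deflate_induct [consumes 1, case_names deflate]:
  fixes A :: "quat^'n^'n"
  assumes "A \<in> qpsd"
    and step: "\<And>A. A \<in> qpsd \<Longrightarrow> (\<And>p. A *v p \<noteq> 0 \<Longrightarrow> P (deflate A p)) \<Longrightarrow> P A"
  shows "P A"
  using assms(1)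
proof (induction "DIM(quat^'n) - dim {v. A *v v = 0}" arbitrary: A rule: less_induct)
  case less
  show ?case
  proof (rule step[OF less.prems])
    fix p assume p: "A *v p \<noteq> 0"
    have sub: "subspace {v. B *v v = 0}" for B :: "quat^'n^'n"
      by (rule linear_subspace_kernel[OF linear_matrix_vector])
    have "dim {v. A *v v = 0} < dim {v. deflate A p *v v = 0}"
      by (rule dim_psubset) (use deflate_kernel[OF less.prems p] sub span_eq_iff in metis)
    moreover have "dim {v. deflate A p *v v = 0} \<le> DIM(quat^'n)"
      by (rule dim_subset_UNIV)
    ultimately show "P (deflate A p)"
      by (intro less.hyps deflate_qpsd less.prems p) linarith
  qed
qed

lemma matrix_vector_eq_0_all:
  fixes A :: "quat^'n^'m"
  assumes "\<And>v. A *v v = 0"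
  shows "A = 0"
  unfolding vec_eq_iff
proof (intro allI)
  fix i j
  show "A $ i $ j = 0 $ i $ j"
    using matrix_vector_axis[of A j 1 i] assms[of "axis j 1"] by simp
qed

lemma outer_scaleR: "outer (r *\<^sub>R g) = (r * r) *\<^sub>R outer g"
  by (simp add: outer_def vec_eq_iff qcnj_scaleR)

text \<open>Repeated deflation stands in for the spectral theorem: each one splits off a positive
  multiple of an outer product, whose factor goes into the vector as a square root.\<close>

lemma qpsd_sum_outer:
  assumes "A \<in> qpsd"
  shows "\<exists>(k::nat) g. A = (\<Sum>l<k. outer (g l))"
  using assms
proof (induction rule: qpsd_deflate_induct)
  case (deflate A)
  show ?case
  proof (cases "\<forall>p. A *v p = 0")
    case True
    then have "A = (\<Sum>l<(0::nat). outer 0)"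
      using matrix_vector_eq_0_all by auto
    then show ?thesis by (rule exI[of _ "0::nat", OF exI[of _ "\<lambda>_. 0"]])
  next
    case False
    then obtain p where p: "A *v p \<noteq> 0" by blast
    from deflate(2)[OF p] obtain k :: nat and g where g: "deflate A p = (\<Sum>l<k. outer (g l))"
      by blast
    define c where "c = 1 / inner p (A *v p)"
    define h where "h = sqrt c *\<^sub>R (A *v p)"
    have "c \<ge> 0" using qpsd_form_pos[OF deflate(1) p] by (simp add: c_def)
    then have "outer h = c *\<^sub>R outer (A *v p)" by (simp add: h_def outer_scaleR)
    then have "A = deflate A p + outer h" by (simp add: deflate_def c_def)
    also have "\<dots> = (\<Sum>l<Suc k. outer ((g(k := h)) l))" by (simp add: g)
    finally show ?thesis by blast
  qed
qed

section \<open>Separable matrices\<close>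

lemma kron_nth [simp]: "kron A B $ (\<alpha>, i) $ (\<beta>, j) = (B $ i $ j) *\<^sub>R (A $ \<alpha> $ \<beta>)"
  by (simp add: kron_def)

lemma rsym_nth: "B \<in> rsym \<Longrightarrow> B $ j $ i = B $ i $ j"
  by (auto simp: rsym_def transpose_def vec_eq_iff)

lemma kron_qherm: "A \<in> qherm \<Longrightarrow> B \<in> rsym \<Longrightarrow> kron A B \<in> qherm"
  by (auto simp: qherm_iff qcnj_scaleR rsym_nth)

text \<open>Turns membership in a span into an entrywise test. For the converse, \<open>M\<close> is
  expanded along symmetrised matrix units; the coefficient matrices \<open>A i j\<close> are
  hermitian because \<open>M\<close> has both symmetries.\<close>

lemma herm_tensor_sym_iff:
  "M \<in> herm_tensor_sym \<longleftrightarrow>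
     M \<in> qherm \<and> (\<forall>\<alpha> \<beta> i j. M $ (\<alpha>, i) $ (\<beta>, j) = M $ (\<alpha>, j) $ (\<beta>, i))"
proof
  let ?S = "{M. M \<in> qherm \<and> (\<forall>\<alpha> \<beta> i j. M $ (\<alpha>, i) $ (\<beta>, j) = M $ (\<alpha>, j) $ (\<beta>, i))}"
  have "subspace ?S"
    using subspace_qherm by (auto simp: subspace_def)
  moreover have "{kron A B | A B. A \<in> qherm \<and> B \<in> rsym} \<subseteq> ?S"
    using kron_qherm by (auto simp: rsym_nth)
  ultimately have "herm_tensor_sym \<subseteq> ?S"
    unfolding herm_tensor_sym_def by (intro span_minimal)
  then show "M \<in> qherm \<and> (\<forall>\<alpha> \<beta> i j. M $ (\<alpha>, i) $ (\<beta>, j) = M $ (\<alpha>, j) $ (\<beta>, i))"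
    if "M \<in> herm_tensor_sym"
    using that by auto
next
  assume M: "M \<in> qherm \<and> (\<forall>\<alpha> \<beta> i j. M $ (\<alpha>, i) $ (\<beta>, j) = M $ (\<alpha>, j) $ (\<beta>, i))"
  define A where "A i j = (\<chi> \<alpha> \<beta>. M $ (\<alpha>, i) $ (\<beta>, j))" for i j
  \<comment> \<open>The double sum meets both (i, j) and (j, i), hence the factor 1/2; for i = j the
    two products add up to 2.\<close>
  define E :: "'b \<Rightarrow> 'b \<Rightarrow> real^'b^'b" where
    "E i j = (\<chi> k l. (1/2) * (of_bool (k = i) * of_bool (l = j) + of_bool (l = i) * of_bool (k = j)))"
    for i j
  have M_eq: "M = (\<Sum>i\<in>UNIV. \<Sum>j\<in>UNIV. kron (A i j) (E i j))"
  proof -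
    have "(\<Sum>i\<in>UNIV. \<Sum>j\<in>UNIV. kron (A i j) (E i j)) $ (\<alpha>, k) $ (\<beta>, l) = M $ (\<alpha>, k) $ (\<beta>, l)"
      for \<alpha> k \<beta> l
    proof -
      have "(\<Sum>i\<in>UNIV. \<Sum>j\<in>UNIV. kron (A i j) (E i j)) $ (\<alpha>, k) $ (\<beta>, l)
          = (\<Sum>i\<in>UNIV. \<Sum>j\<in>UNIV. (1/2) *\<^sub>R ((if k = i then if l = j then A i j $ \<alpha> $ \<beta> else 0 else 0)
            + (if l = i then if k = j then A i j $ \<alpha> $ \<beta> else 0 else 0)))"
        unfolding sum_component kron_nth
        by (intro sum.cong refl)
          (simp only: E_def vec_lambda_beta scaleR_scaleR[symmetric] scaleR_left_distrib, simp)
      also have "\<dots> = (\<Sum>i\<in>UNIV. (1/2) *\<^sub>R ((if k = i then A i l $ \<alpha> $ \<beta> else 0)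
            + (if l = i then A i k $ \<alpha> $ \<beta> else 0)))"
        unfolding scaleR_sum_right[symmetric] sum.distrib
        by (intro sum.cong refl arg_cong2[where f = "(+)"] arg_cong2[where f = scaleR]) auto
      also have "\<dots> = (1/2) *\<^sub>R (A k l $ \<alpha> $ \<beta> + A l k $ \<alpha> $ \<beta>)"
        unfolding scaleR_sum_right[symmetric] sum.distrib by simp
      also have "\<dots> = M $ (\<alpha>, k) $ (\<beta>, l)"
        using M by (auto simp: A_def simp flip: scaleR_2)
      finally show ?thesis .
    qed
    then show ?thesis by (auto simp: vec_eq_iff)
  qed
  have "A i j \<in> qherm" for i j
    using M by (auto simp: A_def qherm_iff)
  moreover have "E i j \<in> rsym" for i j
    by (auto simp: E_def rsym_def transpose_def vec_eq_iff)
  ultimately show "M \<in> herm_tensor_sym"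
    unfolding herm_tensor_sym_def M_eq
    by (intro span_sum span_base) blast
qed

text \<open>Contracting \<open>w\<close> with \<open>g\<close> in the first factor leaves one
  quaternion per index of \<open>B\<close>, so only a form in \<open>B\<close> remains.\<close>

lemma inner_kron_outer:
  "inner w (kron (outer g) B *v w)
     = (\<Sum>i\<in>UNIV. \<Sum>j\<in>UNIV. B $ i $ j * inner (hdot g (\<chi> \<alpha>. w $ (\<alpha>, i))) (hdot g (\<chi> \<alpha>. w $ (\<alpha>, j))))"
proof -
  let ?s = "\<lambda>i. hdot g (\<chi> \<alpha>. w $ (\<alpha>, i))"
  have row: "(kron (outer g) B *v w) $ (\<alpha>, i) = (\<Sum>j\<in>UNIV. (B $ i $ j) *\<^sub>R (g $ \<alpha> * ?s j))" for \<alpha> i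
  proof -
    have "(kron (outer g) B *v w) $ (\<alpha>, i)
        = (\<Sum>\<beta>\<in>UNIV. \<Sum>j\<in>UNIV. (B $ i $ j) *\<^sub>R (g $ \<alpha> * (qcnj (g $ \<beta>) * w $ (\<beta>, j))))"
      by (simp add: matrix_vector_mult_def outer_def mult.assoc sum.cartesian_product
          flip: UNIV_Times_UNIV)
        (simp add: case_prod_unfold kron_def mult.assoc)
    also have "\<dots> = (\<Sum>j\<in>UNIV. \<Sum>\<beta>\<in>UNIV. (B $ i $ j) *\<^sub>R (g $ \<alpha> * (qcnj (g $ \<beta>) * w $ (\<beta>, j))))"
      by (rule sum.swap)
    finally show ?thesis
      by (simp add: hdot_def sum_distrib_left scaleR_sum_right)
  qed
  have "inner w (kron (outer g) B *v w)
      = (\<Sum>\<alpha>\<in>UNIV. \<Sum>i\<in>UNIV. inner (w $ (\<alpha>, i)) ((kron (outer g) B *v w) $ (\<alpha>, i)))"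
    by (simp add: inner_vec_def sum.cartesian_product flip: UNIV_Times_UNIV)
  also have "\<dots> = (\<Sum>i\<in>UNIV. \<Sum>\<alpha>\<in>UNIV. inner (w $ (\<alpha>, i)) ((kron (outer g) B *v w) $ (\<alpha>, i)))"
    by (rule sum.swap)
  also have "\<dots> = (\<Sum>i\<in>UNIV. \<Sum>\<alpha>\<in>UNIV. \<Sum>j\<in>UNIV.
      B $ i $ j * inner (qcnj (g $ \<alpha>) * w $ (\<alpha>, i)) (?s j))"
    by (simp add: row inner_sum_right inner_quat_mult_left)
  also have "\<dots> = (\<Sum>i\<in>UNIV. \<Sum>j\<in>UNIV. \<Sum>\<alpha>\<in>UNIV.
      B $ i $ j * inner (qcnj (g $ \<alpha>) * w $ (\<alpha>, i)) (?s j))"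
    by (intro sum.cong refl sum.swap)
  also have "\<dots> = (\<Sum>i\<in>UNIV. \<Sum>j\<in>UNIV. B $ i $ j * inner (?s i) (?s j))"
    by (simp add: hdot_def inner_sum_left sum_distrib_left)
  finally show ?thesis .
qed

lemma rpsd_form_nonneg:
  assumes "B \<in> rpsd"
  shows "0 \<le> (\<Sum>i\<in>UNIV. \<Sum>j\<in>UNIV. B $ i $ j * (x i * x j))"
proof -
  have "0 \<le> inner (\<chi> i. x i) (B *v (\<chi> i. x i))"
    using assms by (simp add: rpsd_def)
  also have "\<dots> = (\<Sum>i\<in>UNIV. \<Sum>j\<in>UNIV. B $ i $ j * (x i * x j))"
    by (simp add: inner_vec_def matrix_vector_mult_def sum_distrib_left algebra_simps)
  finally show ?thesis .
qed

text \<open>For A = g g^* the form splits into four real forms of \<open>B\<close>, one per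
  quaternion coordinate. \<open>qpsd_sum_outer\<close> reduces the general case to this one.\<close>

lemma kron_qpsd:
  fixes A :: "quat^'m^'m" and B :: "real^'n^'n"
  assumes A: "A \<in> qpsd" and B: "B \<in> rpsd"
  shows "kron A B \<in> qpsd"
proof -
  have Bs: "B \<in> rsym" using B by (simp add: rpsd_def)
  have *: "kron (outer g) B \<in> qpsd" for g :: "quat^'m"
    unfolding qpsd_iff inner_kron_outer
  proof (intro conjI allI)
    show "kron (outer g) B \<in> qherm" by (rule kron_qherm[OF outer_qherm Bs])
    fix w :: "quat^('m \<times> 'n)"
    let ?s = "\<lambda>i. hdot g (\<chi> \<alpha>. w $ (\<alpha>, i))"
    show "0 \<le> (\<Sum>i\<in>UNIV. \<Sum>j\<in>UNIV. B $ i $ j * inner (?s i) (?s j))"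
      using rpsd_form_nonneg[OF B, of "\<lambda>i. qRe (?s i)"] rpsd_form_nonneg[OF B, of "\<lambda>i. qIm1 (?s i)"]
        rpsd_form_nonneg[OF B, of "\<lambda>i. qIm2 (?s i)"] rpsd_form_nonneg[OF B, of "\<lambda>i. qIm3 (?s i)"]
      unfolding inner_quat_def distrib_left sum.distrib by linarith
  qed
  obtain k :: nat and g where "A = (\<Sum>l<k. outer (g l))"
    using qpsd_sum_outer[OF A] by blast
  then have "kron A B = (\<Sum>l<k. kron (outer (g l)) B)"
    by (simp add: vec_eq_iff kron_def scaleR_sum_right)
  then show ?thesis by (simp add: qpsd_sum *)
qed

lemma separable_qpsd: "separable M \<Longrightarrow> M \<in> qpsd"
  unfolding separable_def by (auto intro!: qpsd_sum kron_qpsd)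

lemma separable_kron:
  assumes "A \<in> qpsd" "B \<in> rpsd"
  shows "separable (kron A B)"
  unfolding separable_def
  by (rule exI[of _ 1], rule exI[of _ "\<lambda>_. A"], rule exI[of _ "\<lambda>_. B"]) (simp add: assms)

lemma separable_add_kron:
  assumes "separable M" "A \<in> qpsd" "B \<in> rpsd"
  shows "separable (M + kron A B)"
proof -
  obtain k :: nat and F G where
    "\<forall>l<k. F l \<in> qpsd \<and> G l \<in> rpsd" "M = (\<Sum>l<k. kron (F l) (G l))"
    using assms(1) unfolding separable_def by blast
  then have "(\<forall>l<Suc k. (F(k := A)) l \<in> qpsd \<and> (G(k := B)) l \<in> rpsd)
      \<and> M + kron A B = (\<Sum>l<Suc k. kron ((F(k := A)) l) ((G(k := B)) l))"
    using assms(2,3) by (auto simp: less_Suc_eq)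
  then show ?thesis unfolding separable_def by blast
qed

lemma rpsd_rank_one: "(\<chi> i j. x i * x j) \<in> rpsd"
proof -
  have "inner v ((\<chi> i j. x i * x j) *v v) = (\<Sum>i\<in>UNIV. x i * v $ i)\<^sup>2" for v
    by (simp add: inner_vec_def matrix_vector_mult_def power2_eq_square sum_product
        sum_distrib_left algebra_simps)
  then show ?thesis
    by (simp add: rpsd_def rsym_def transpose_def vec_eq_iff mult.commute)
qed

section \<open>The separable cases\<close>

text \<open>The only block is both symmetric and hermitian, so every entry equals its own conjugate
  and the matrix is real.\<close>

lemma qpsd_separable_one:
  fixes M :: "quat^('m::finite \<times> 'n::finite)^('m \<times> 'n)"
  assumes m: "CARD('m) = 1" and M: "M \<in> herm_tensor_sym" "M \<in> qpsd"
  shows "separable M"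
proof -
  obtain a :: 'm where a: "UNIV = {a}"
    using m card_1_singletonE by blast
  define B :: "real^'n^'n" where "B = (\<chi> i j. qRe (M $ (a, i) $ (a, j)))"
  have herm: "qcnj (M $ (a, j) $ (a, i)) = M $ (a, i) $ (a, j)"
    and sym: "M $ (a, i) $ (a, j) = M $ (a, j) $ (a, i)" for i j
    using M(1) unfolding herm_tensor_sym_iff qherm_iff by blast+
  have real: "M $ (a, i) $ (a, j) = B $ i $ j *\<^sub>R 1" for i j
    using herm[of i j] sym[of i j] by (simp add: B_def quat_eq_iff quat_defs)
  have sum_pairs: "sum f UNIV = (\<Sum>i\<in>UNIV. f (a, i))" for f :: "'m \<times> 'n \<Rightarrow> 'c::comm_monoid_add"
    unfolding UNIV_Times_UNIV[symmetric] sum.cartesian_product' a by simp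
  have eqa: "\<alpha> = a" for \<alpha>
    using a by blast
  have "M = kron (outer (\<chi> _. 1)) B"
    unfolding vec_eq_iff
  proof (intro allI, clarify)
    fix \<alpha> i \<beta> j
    show "M $ (\<alpha>, i) $ (\<beta>, j) = kron (outer (\<chi> _. 1)) B $ (\<alpha>, i) $ (\<beta>, j)"
      using real[of i j] eqa[of \<alpha>] eqa[of \<beta>] by (simp add: outer_def qcnj_def one_quat_def times_quat_def)
  qed
  moreover have "B \<in> rpsd"
    unfolding rpsd_def
  proof (intro CollectI conjI allI)
    show "B \<in> rsym"
      using sym by (simp add: rsym_def transpose_def B_def vec_eq_iff)
    fix x :: "real^'n"
    have "0 \<le> inner (\<chi> p. x $ snd p *\<^sub>R 1) (M *v (\<chi> p. x $ snd p *\<^sub>R 1))"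
      using M(2) by (simp add: qpsd_iff)
    also have "\<dots> = (\<Sum>i\<in>UNIV. \<Sum>j\<in>UNIV. x $ i * (x $ j * B $ i $ j))"
      unfolding inner_vec_def matrix_vector_mult_def sum_pairs
      by (simp add: real inner_sum_right sum_distrib_left inner_quat_1 mult_ac)
    also have "\<dots> = inner x (B *v x)"
      by (simp add: inner_vec_def matrix_vector_mult_def sum_distrib_left algebra_simps)
    finally show "0 \<le> inner x (B *v x)" .
  qed
  ultimately show ?thesis
    using separable_kron[OF outer_qpsd] by simp
qed

text \<open>On the range of \<open>f\<close> the form of \<open>f\<close> is positive definite, so
  the quotient of the two forms attains a maximum y on the unit sphere there, at some u. Then y f -
  g is nonnegative with form zero at u, so it kills u.\<close>

lemma generalized_eigenvector:
  fixes f g :: "'a::euclidean_space \<Rightarrow> 'a"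
  assumes f: "linear f" "\<And>u v. inner u (f v) = inner (f u) v" "\<And>v. 0 \<le> inner v (f v)"
    and g: "linear g" "\<And>u v. inner u (g v) = inner (g u) v"
    and ker: "\<And>v. f v = 0 \<Longrightarrow> g v = 0" and "f z \<noteq> 0"
  obtains u y where "f u \<noteq> 0" "g u = y *\<^sub>R f u"
proof -
  define V where "V = range f"
  have V: "subspace V" unfolding V_def by (rule linear_subspace_image[OF f(1) subspace_UNIV])
  define S where "S = V \<inter> sphere 0 1"
  have "compact S"
    unfolding S_def by (intro closed_Int_compact closed_subspace V compact_sphere)
  moreover have "(1 / norm (f z)) *\<^sub>R f z \<in> S"
    using \<open>f z \<noteq> 0\<close> subspace_scale[OF V] by (auto simp: S_def V_def)
  then have "S \<noteq> {}" by blast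
  moreover have nz: "f u \<noteq> 0" if "u \<in> V" "u \<noteq> 0" for u
  proof
    assume "f u = 0"
    obtain w where "u = f w" using \<open>u \<in> V\<close> by (auto simp: V_def)
    then have "inner u u = inner (f u) w" using f(2)[of u w] by simp
    then show False using \<open>f u = 0\<close> \<open>u \<noteq> 0\<close> by simp
  qed
  have pos: "0 < inner u (f u)" if "u \<in> V" "u \<noteq> 0" for u
    using nonneg_self_adjoint_eq_0[OF f, of u] nz[OF that] f(3)[of u] by force
  have S0: "u \<in> V" "u \<noteq> 0" if "u \<in> S" for u
    using that by (auto simp: S_def)
  have "continuous_on S (\<lambda>u. inner u (g u) / inner u (f u))"
    using S0 pos by (intro continuous_intros linear_continuous_on_compose[OF continuous_on_id]
        f(1) g(1)) force
  ultimately obtain u where u: "u \<in> S"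
    and max: "\<And>v. v \<in> S \<Longrightarrow> inner v (g v) / inner v (f v) \<le> inner u (g u) / inner u (f u)"
    using continuous_attains_sup[of S] by blast
  define y where "y = inner u (g u) / inner u (f u)"
  define h where "h v = y *\<^sub>R f v - g v" for v
  have h: "linear h"
    unfolding h_def by (intro linear_compose_sub linear_compose_scale_right f g)
  have hsa: "inner u (h v) = inner (h u) v" for u v
    by (simp add: h_def inner_diff_left inner_diff_right f(2) g(2))
  have hV: "0 \<le> inner v (h v)" if "v \<in> V" for v
  proof (cases "v = 0")
    case False
    let ?v = "(1 / norm v) *\<^sub>R v"
    have "?v \<in> S" using that False subspace_scale[OF V] by (simp add: S_def)
    from max[OF this] have "inner v (g v) / inner v (f v) \<le> y"
      using False by (simp add: y_def linear_scale[OF f(1)] linear_scale[OF g(1)])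
    then show ?thesis
      using pos[OF that False] by (simp add: h_def inner_diff_right field_simps)
  qed simp
  \<comment> \<open>The component of \<open>w\<close> orthogonal to the range lies in the kernel of
    \<open>f\<close>, hence by \<open>ker\<close> in that of \<open>g\<close>, and contributes
    nothing.\<close>
  have "0 \<le> inner w (h w)" for w
  proof -
    obtain v z where v: "v \<in> span V" and z: "\<And>w. w \<in> span V \<Longrightarrow> orthogonal z w" and w: "w = v + z"
      using orthogonal_subspace_decomp_exists[of V w] by blast
    have "inner (f z) (f z) = inner z (f (f z))" by (simp add: f(2))
    also have "\<dots> = 0" using z[of "f (f z)"] by (simp add: orthogonal_def V_def span_base)
    finally have "h z = 0" by (simp add: h_def ker)
    then have "inner w (h w) = inner v (h v)"
      by (simp add: w linear_add[OF h] inner_add_left hsa[of z v])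
    then show ?thesis using hV v V span_eq_iff by metis
  qed
  moreover have "inner u (h u) = 0"
    using pos[of u] S0[OF u] by (simp add: h_def inner_diff_right y_def)
  ultimately have "h u = 0"
    by (intro nonneg_self_adjoint_eq_0[OF h hsa])
  then have "g u = y *\<^sub>R f u" by (simp add: h_def)
  then show thesis using that nz S0[OF u] by blast
qed

text \<open>The vector \<open>p\<close> is chosen so that \<open>M *v p\<close> is a quaternionic
  vector times a real one. Then the subtracted term is separable, and the rest stays in
  \<open>herm_tensor_sym\<close>, as the induction requires.\<close>

lemma qpsd_separable_two:
  fixes M :: "quat^('m::finite \<times> 'n::finite)^('m \<times> 'n)"
  assumes n: "CARD('n) \<le> 2" and "M \<in> qpsd" "M \<in> herm_tensor_sym"
  shows "separable M"
proof -
  \<comment> \<open>The case \<open>b = c\<close> is allowed and covers n = 1.\<close>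
  obtain b c :: 'n where "(UNIV :: 'n set) = {b, c}"
  proof (cases "CARD('n) = 2")
    case True
    then show ?thesis using that by (auto simp: card_2_iff)
  next
    case False
    moreover have "CARD('n) \<noteq> 0" by simp
    ultimately have "CARD('n) = 1" using n by linarith
    then obtain b where "(UNIV :: 'n set) = {b}" by (rule card_1_singletonE)
    then show ?thesis using that[of b b] by simp
  qed
  then have bc: "i = b \<or> i = c" for i
    by blast
  from assms(2,3) show ?thesis
  proof (induction rule: qpsd_deflate_induct)
    case (deflate M)
    define emb where "emb k u = (\<chi> p. if snd p = k then u $ fst p else 0)" for k :: 'n and u :: "quat^'m"
    define blk where "blk i j = (\<chi> \<alpha> \<beta>. M $ (\<alpha>, i) $ (\<beta>, j))" for i j
    have sym: "M $ (\<alpha>, i) $ (\<beta>, j) = M $ (\<alpha>, j) $ (\<beta>, i)" for \<alpha> \<beta> i j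
      using deflate.prems unfolding herm_tensor_sym_iff by blast
    have herm: "M \<in> qherm"
      using deflate.prems unfolding herm_tensor_sym_iff by blast
    have blk_herm: "blk i j \<in> qherm" for i j
      using qhermD[OF herm] sym by (simp add: blk_def qherm_iff)
    have M_emb: "(M *v emb k u) $ (\<alpha>, i) = (blk i k *v u) $ \<alpha>" for k u \<alpha> i
      unfolding matrix_vector_mult_def emb_def blk_def UNIV_Times_UNIV[symmetric]
        sum.cartesian_product'
      by (simp add: if_distrib[of "\<lambda>x. _ * x"] cong: if_cong)
    have form_emb: "inner (emb k u) (M *v emb k u) = inner u (blk k k *v u)" for k u
      unfolding inner_vec_def UNIV_Times_UNIV[symmetric] sum.cartesian_product' M_emb
      by (simp add: emb_def if_distrib[of "\<lambda>x. inner x _"] cong: if_cong)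
    have blk_psd: "blk k k \<in> qpsd" for k
      using deflate.hyps(1) blk_herm form_emb unfolding qpsd_iff by metis
    have ker: "M *v emb b u = 0" if "blk b b *v u = 0" for u
      using qpsd_eq_0[OF deflate.hyps(1), of "emb b u"] that by (simp add: form_emb)
    show ?case
    proof (cases "\<forall>u. blk b b *v u = 0")
      \<comment> \<open>Block row and column \<open>b\<close> vanish, leaving only the block at (c,
        c). If \<open>b = c\<close> then \<open>M = 0\<close>, and the equation still holds.\<close>
      case True
      have col: "M $ p $ (\<beta>, b) = 0" for p \<beta>
        using arg_cong[OF ker[of "axis \<beta> 1"], of "\<lambda>v. v $ p"] True M_emb[of b "axis \<beta> 1" "fst p" "snd p"]
        by (simp add: matrix_vector_axis blk_def)
      have row: "M $ (\<beta>, b) $ p = 0" for p \<beta>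
        using qhermD[OF herm, of p "(\<beta>, b)"] by (simp add: col)
      have "M = kron (blk c c) (\<chi> i j. of_bool (i = c) * of_bool (j = c))"
        unfolding vec_eq_iff
      proof (intro allI, clarify)
        fix \<alpha> i \<beta> j
        show "M $ (\<alpha>, i) $ (\<beta>, j)
            = kron (blk c c) (\<chi> i j. of_bool (i = c) * of_bool (j = c)) $ (\<alpha>, i) $ (\<beta>, j)"
          using bc[of i] bc[of j] col row by (auto simp: blk_def)
      qed
      then show ?thesis
        using separable_kron[OF blk_psd[of c] rpsd_rank_one] by simp
    next
      case False
      then obtain z where z: "blk b b *v z \<noteq> 0" by blast
      \<comment> \<open>Positivity of the whole of \<open>M\<close> forces this kernel inclusion,
        the hypothesis of \<open>generalized_eigenvector\<close>.\<close>
      have "blk c b *v u = 0" if "blk b b *v u = 0" for u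
        using M_emb[of b u _ c] ker[OF that] by (simp add: vec_eq_iff)
      from generalized_eigenvector[of "\<lambda>v. blk b b *v v" "\<lambda>v. blk c b *v v" z,
          OF linear_matrix_vector qherm_self_adjoint(2)[OF blk_herm] _
            linear_matrix_vector qherm_self_adjoint(2)[OF blk_herm] this z]
      obtain u y where u: "blk b b *v u \<noteq> 0" "blk c b *v u = y *\<^sub>R (blk b b *v u)"
        using blk_psd[of b] unfolding qpsd_iff by metis
      \<comment> \<open>The real factor of the product vector: 1 at \<open>b\<close> and the
        eigenvalue at \<open>c\<close>.\<close>
      define x where "x i = (if i = b then 1 else y)" for i
      define v where "v = blk b b *v u"
      define p where "p = emb b u"
      have Mp: "(M *v p) $ (\<alpha>, i) = x i *\<^sub>R v $ \<alpha>" for \<alpha> i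
        using bc[of i] u(2) by (auto simp: p_def M_emb x_def v_def)
      obtain \<alpha> where "v $ \<alpha> \<noteq> 0" using u(1) by (auto simp: v_def vec_eq_iff)
      then have "M *v p \<noteq> 0" using Mp[of \<alpha> b] by (auto simp: x_def)
      define r where "r = 1 / inner p (M *v p)"
      have "r \<ge> 0"
        using qpsd_form_pos[OF deflate.hyps(1) \<open>M *v p \<noteq> 0\<close>] by (simp add: r_def)
      have outer_eq: "outer (M *v p) = kron (outer v) (\<chi> i j. x i * x j)"
        by (auto simp: vec_eq_iff outer_def Mp qcnj_scaleR)
      then have "r *\<^sub>R outer (M *v p) = kron (r *\<^sub>R outer v) (\<chi> i j. x i * x j)"
        by (simp add: vec_eq_iff kron_def mult.commute)
      then have M_eq: "M = deflate M p + kron (r *\<^sub>R outer v) (\<chi> i j. x i * x j)"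
        by (simp add: deflate_def r_def)
      have psd: "r *\<^sub>R outer v \<in> qpsd"
        by (rule qpsd_scaleR[OF \<open>r \<ge> 0\<close> outer_qpsd])
      have "kron (r *\<^sub>R outer v) (\<chi> i j. x i * x j) \<in> herm_tensor_sym"
        unfolding herm_tensor_sym_def
        using psd rpsd_rank_one[of x] by (intro span_base) (auto simp: qpsd_iff rpsd_def)
      then have "deflate M p \<in> herm_tensor_sym"
        using M_eq deflate.prems span_diff unfolding herm_tensor_sym_def
        by (metis (no_types, lifting) add_diff_cancel_right')
      from deflate.IH[OF \<open>M *v p \<noteq> 0\<close> this] show ?thesis
        using separable_add_kron[OF _ psd rpsd_rank_one] M_eq by metis
    qed
  qed
qed

section \<open>An entangled matrix\<close>

text \<open>A row (v, w) tensor (x, y, z) annihilates two kernel vectors of the entangled matrix.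
  For x nonzero the factors of w are invertible; solving both equations for w and cancelling v
  leaves one quaternion equation in x, y, z.\<close>

lemma no_product_vector:
  fixes v w :: quat and x y z :: real
  assumes eq1: "v * Quat (7 * y) (- (2 * z)) 0 x + w * Quat y 0 0 (- (3 * x)) = 0"
    and eq2: "v * Quat (- (7 * z)) (- (2 * y)) x 0 + w * Quat z 0 (3 * x) 0 = 0"
  shows "v = 0 \<or> x = 0"
proof (rule ccontr)
  assume "\<not> (v = 0 \<or> x = 0)"
  then have v: "v \<noteq> 0" and x: "x \<noteq> 0" by auto
  let ?n = "Quat (7 * y) (- (2 * z)) 0 x" and ?d = "Quat y 0 0 (- (3 * x))"
  let ?n' = "Quat (- (7 * z)) (- (2 * y)) x 0" and ?d' = "Quat z 0 (3 * x) 0"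
  \<comment> \<open>Squared norms of \<open>?d\<close> and \<open>?d'\<close>; multiplying by
    conjugates avoids quaternionic inverses.\<close>
  define p q where "p = y\<^sup>2 + 9 * x\<^sup>2" and "q = z\<^sup>2 + 9 * x\<^sup>2"
  have pq: "p > 0" "q > 0" using x by (simp_all add: p_def q_def add_nonneg_pos)
  have d: "?d * qcnj ?d = of_real p" "?d' * qcnj ?d' = of_real q"
    by (simp_all add: quat_mult_qcnj inner_quat_def p_def q_def power2_eq_square)
  have "v * ?n * qcnj ?d + p *\<^sub>R w = (v * ?n + w * ?d) * qcnj ?d"
    by (simp add: distrib_right mult.assoc d of_real_def)
  then have 1: "v * (?n * qcnj ?d) = - (p *\<^sub>R w)"
    by (simp add: eq1 mult.assoc eq_neg_iff_add_eq_0)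
  have "v * ?n' * qcnj ?d' + q *\<^sub>R w = (v * ?n' + w * ?d') * qcnj ?d'"
    by (simp add: distrib_right mult.assoc d of_real_def)
  then have 2: "v * (?n' * qcnj ?d') = - (q *\<^sub>R w)"
    by (simp add: eq2 mult.assoc eq_neg_iff_add_eq_0)
  have "v * (q *\<^sub>R (?n * qcnj ?d) - p *\<^sub>R (?n' * qcnj ?d')) = 0"
    unfolding right_diff_distrib mult_scaleR_right 1 2 by simp
  then have eq: "q *\<^sub>R (?n * qcnj ?d) - p *\<^sub>R (?n' * qcnj ?d') = 0"
    using quat_no_zero_divisors v by blast
  have re: "q * (7 * y\<^sup>2 - 3 * x\<^sup>2) = p * (3 * x\<^sup>2 - 7 * z\<^sup>2)"
    using arg_cong[OF eq, of qRe] by (simp add: quat_defs power2_eq_square algebra_simps)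
  have im2: "x * z * (6 * q - 22 * p) = 0"
    using arg_cong[OF eq, of qIm2] by (simp add: quat_defs algebra_simps)
  have im3: "x * y * (22 * q - 6 * p) = 0"
    using arg_cong[OF eq, of qIm3] by (simp add: quat_defs algebra_simps)
  \<comment> \<open>A nonzero z forces q : p = 11 : 3 and a nonzero y forces 3 : 11, so not both are
    nonzero. If exactly one is, its square is 24 x^2, against \<open>re\<close>; if neither is, the
    sides of \<open>re\<close> have opposite signs.\<close>
  consider "y = 0" "z = 0" | "y = 0" "z \<noteq> 0" | "y \<noteq> 0" "z = 0" | "y \<noteq> 0" "z \<noteq> 0"
    by blast
  then show False
  proof cases
    case 1
    then show False using re x by (simp add: p_def q_def)
  next
    case 2
    then have z: "z\<^sup>2 = 24 * x\<^sup>2" using im2 x by (simp add: p_def q_def)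
    show False using re x unfolding p_def q_def z by (simp add: 2)
  next
    case 3
    then have y: "y\<^sup>2 = 24 * x\<^sup>2" using im3 x by (simp add: p_def q_def)
    show False using re x unfolding p_def q_def y by (simp add: 3)
  next
    case 4
    then show False using im2 im3 x pq by simp
  qed
qed

text \<open>A 2 by 3 example sits at two block indices and three inner indices, with zeros
  elsewhere, and so serves all larger sizes.\<close>

lemma exists_entangled:
  assumes m: "CARD('m::finite) \<noteq> 1" and n: "\<not> CARD('n::finite) \<le> 2"
  shows "\<exists>M :: quat^('m \<times> 'n)^('m \<times> 'n). M \<in> herm_tensor_sym \<and> M \<in> qpsd \<and> \<not> separable M"
proof -
  have "\<not> (UNIV :: 'm set) \<subseteq> {a}" for a
    using m card_mono[of "{a}" "UNIV :: 'm set"] by (auto simp: le_Suc_eq)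
  then obtain a1 a2 :: 'm where a: "a1 \<noteq> a2"
    by blast
  have "3 \<le> card (UNIV :: 'n set)" using n by simp
  then obtain T :: "'n set" where "card T = 3"
    using obtain_subset_with_card_n by blast
  then obtain b1 b2 b3 :: 'n where b: "b1 \<noteq> b2" "b1 \<noteq> b3" "b2 \<noteq> b3"
    by (auto simp: card_3_iff)
  define sel :: "quat \<Rightarrow> quat \<Rightarrow> quat \<Rightarrow> 'n \<Rightarrow> quat" where
    "sel x y z i = (if i = b1 then x else if i = b2 then y else if i = b3 then z else 0)" for x y z i
  define vec where
    "vec f g = (\<chi> p. if fst p = a1 then f (snd p) else if fst p = a2 then g (snd p) else 0)"
    for f g :: "'n \<Rightarrow> quat"
  \<comment> \<open>The columns of G, for Q with rows (0, k, j), (k, -4, i), (j, i, 4) and v = (i,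
    -3j, -3k). Then Q Q^* + v v^* = diag(3, 27, 27), so \<open>M\<close> has the blocks I, Q^*, Q
    and this diagonal matrix, all symmetric.\<close>
  define g1 where "g1 = vec (sel 1 0 0) (sel 0 (Quat 0 0 0 1) (Quat 0 0 1 0))"
  define g2 where "g2 = vec (sel 0 1 0) (sel (Quat 0 0 0 1) (Quat (-4) 0 0 0) (Quat 0 1 0 0))"
  define g3 where "g3 = vec (sel 0 0 1) (sel (Quat 0 0 1 0) (Quat 0 1 0 0) (Quat 4 0 0 0))"
  define g4 where "g4 = vec (sel 0 0 0) (sel (Quat 0 1 0 0) (Quat 0 0 (-3) 0) (Quat 0 0 0 (-3)))"
  define M where "M = outer g1 + outer g2 + outer g3 + outer g4"
  have sel: "sel x y z b1 = x" "sel x y z b2 = y" "sel x y z b3 = z" for x y z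
    using b by (simp_all add: sel_def)
  have sel0: "sel x y z i = 0" if "i \<noteq> b1" "i \<noteq> b2" "i \<noteq> b3" for x y z i
    using that by (simp add: sel_def)
  have vec: "vec f g $ (a1, i) = f i" "vec f g $ (a2, i) = g i" for f g i
    using a by (simp_all add: vec_def)
  have vec0: "vec f g $ (\<alpha>, i) = 0" if "\<alpha> \<noteq> a1" "\<alpha> \<noteq> a2" for f g \<alpha> i
    using that by (simp add: vec_def)
  have M_nth: "M $ p $ q = g1 $ p * qcnj (g1 $ q) + g2 $ p * qcnj (g2 $ q) + g3 $ p * qcnj (g3 $ q)
      + g4 $ p * qcnj (g4 $ q)" for p q
    by (simp add: M_def outer_def)
  have psd: "M \<in> qpsd"
    unfolding M_def by (intro qpsd_add outer_qpsd)
  have "M $ (\<alpha>, i) $ (\<beta>, j) = M $ (\<alpha>, j) $ (\<beta>, i)" for \<alpha> \<beta> i j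
  proof -
    have "\<alpha> = a1 \<or> \<alpha> = a2 \<or> (\<alpha> \<noteq> a1 \<and> \<alpha> \<noteq> a2)" by blast
    moreover have "\<beta> = a1 \<or> \<beta> = a2 \<or> (\<beta> \<noteq> a1 \<and> \<beta> \<noteq> a2)" by blast
    moreover have "i = b1 \<or> i = b2 \<or> i = b3 \<or> (i \<noteq> b1 \<and> i \<noteq> b2 \<and> i \<noteq> b3)" by blast
    moreover have "j = b1 \<or> j = b2 \<or> j = b3 \<or> (j \<noteq> b1 \<and> j \<noteq> b2 \<and> j \<noteq> b3)" by blast
    ultimately show ?thesis
      unfolding M_nth g1_def g2_def g3_def g4_def
      by (elim disjE conjE) (simp_all add: vec vec0 sel sel0 quat_defs)
  qed
  then have tensor: "M \<in> herm_tensor_sym"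
    using psd by (simp add: herm_tensor_sym_iff qpsd_iff)
  have "\<not> separable M"
  proof
    assume "separable M"
    then obtain k :: nat and A B where AB: "\<And>l. l < k \<Longrightarrow> kron (A l) (B l) \<in> qpsd"
      and M_eq: "M = (\<Sum>l<k. kron (A l) (B l))"
      unfolding separable_def using kron_qpsd by metis
    \<comment> \<open>the vectors $(-Q^* s, s)$ with $v^* s = 0$ for $s = (-3k, 1, 0)$ and $s = (3j, 0, 1)$;
      they span the kernel of $M$ on the six chosen coordinates\<close>
    define u where "u = axis (a1, b1) (Quat 0 0 0 1) + axis (a1, b2) (Quat 7 0 0 0)
      + axis (a1, b3) (Quat 0 (-2) 0 0) + axis (a2, b1) (Quat 0 0 0 (-3)) + axis (a2, b2) 1"
    define w where "w = axis (a1, b1) (Quat 0 0 1 0) + axis (a1, b2) (Quat 0 (-2) 0 0)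
      + axis (a1, b3) (Quat (-7) 0 0 0) + axis (a2, b1) (Quat 0 0 3 0) + axis (a2, b3) 1"
    have hdot_u: "hdot g u = 0" and hdot_w: "hdot g w = 0" if "g \<in> {g1, g2, g3, g4}" for g
      using that by (auto simp: u_def w_def hdot_add hdot_axis vec sel g1_def g2_def g3_def g4_def
          quat_defs)
    \<comment> \<open>The form of \<open>M\<close> at \<open>v\<close> is zero and is a sum of
      nonnegative forms, so each of them vanishes at \<open>v\<close>.\<close>
    have ker: "kron (A l) (B l) *v v = 0"
      if v: "\<And>g. g \<in> {g1, g2, g3, g4} \<Longrightarrow> hdot g v = 0" and l: "l < k" for l v
    proof -
      have "inner v (M *v v) = 0"
        by (simp add: M_def matrix_vector_mult_add_rdistrib inner_right_distrib inner_outer v)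
      then have "(\<Sum>l<k. inner v (kron (A l) (B l) *v v)) = 0"
        by (simp add: M_eq sum_matrix_vector inner_sum_right)
      then have "inner v (kron (A l) (B l) *v v) = 0"
        using sum_nonneg_eq_0_iff[of "{..<k}" "\<lambda>l. inner v (kron (A l) (B l) *v v)"] AB l
        by (simp add: qpsd_iff)
      then show ?thesis by (rule qpsd_eq_0[OF AB[OF l]])
    qed
    \<comment> \<open>Row (a1, b1) of a summand is a product vector killing \<open>u\<close> and
      \<open>w\<close>, which makes its diagonal entry zero. The same entry of \<open>M\<close> is
      1.\<close>
    have "kron (A l) (B l) $ (a1, b1) $ (a1, b1) = 0" if l: "l < k" for l
    proof -
      define v v' where "v = A l $ a1 $ a1" and "v' = A l $ a1 $ a2"
      define x y z where "x = B l $ b1 $ b1" and "y = B l $ b1 $ b2" and "z = B l $ b1 $ b3"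
      have "v * Quat (7 * y) (- (2 * z)) 0 x + v' * Quat y 0 0 (- (3 * x))
          = (kron (A l) (B l) *v u) $ (a1, b1)"
        unfolding u_def matrix_vector_right_distrib vector_add_component matrix_vector_axis kron_nth
        by (simp add: v_def v'_def x_def y_def z_def quat_defs algebra_simps)
      moreover have "v * Quat (- (7 * z)) (- (2 * y)) x 0 + v' * Quat z 0 (3 * x) 0
          = (kron (A l) (B l) *v w) $ (a1, b1)"
        unfolding w_def matrix_vector_right_distrib vector_add_component matrix_vector_axis kron_nth
        by (simp add: v_def v'_def x_def y_def z_def quat_defs algebra_simps)
      ultimately have "v = 0 \<or> x = 0"
        using ker[OF hdot_u l] ker[OF hdot_w l] no_product_vector by simp
      then show ?thesis by (auto simp: v_def x_def)
    qed
    then have "M $ (a1, b1) $ (a1, b1) = 0"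
      unfolding M_eq sum_component by (intro sum.neutral) blast
    moreover have "M $ (a1, b1) $ (a1, b1) = 1"
      by (simp add: M_nth g1_def g2_def g3_def g4_def vec sel quat_defs)
    ultimately show False by simp
  qed
  then show ?thesis using psd tensor by blast
qed

theorem theorem8p2:
  shows "{M :: quat^('m::finite \<times> 'n::finite)^('m \<times> 'n). M \<in> herm_tensor_sym \<and> separable M}
           = {M. M \<in> herm_tensor_sym \<and> M \<in> qpsd}
         \<longleftrightarrow> CARD('n) \<le> 2 \<or> CARD('m) = 1"
  using separable_qpsd qpsd_separable_one qpsd_separable_two exists_entangled[where 'm = 'm and 'n = 'n]
  by blast

end
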